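(* Let $(C,\le)$ be a causal set. (a) For every integer $n\ge1$, every maximising geodesic $\gamma=(x_0,\dots,x_{n+1})$ in $C$ and every $\alpha\in[0,1]$, $$\kappa_1(\gamma)=\kappa_1^\alpha(\gamma)=\kappa_1^{\mathrm{LLY}}(\gamma)=0.$$ (b) For all integers $n\ge r\ge1$ and every maximising geodesic $\gamma=(x_0,\dots,x_{n+r})$ in $C$, the idle curvature with idleness $\alpha=1$ vanishes: $\kappa_r^{1}(\gamma)=0$.
   Context: A causal set is a pair $(C,\le)$ where $\le$ is a partial order on the set $C$ such that every causal diamond $J(x,z)=\{y\in C:x\le y\le z\}$ is finite. Write $x\ll y$ if $x\le y$ and $x\ne y$. The time separation is $\tau(x,y)=\max\{m: x=z_0\ll z_1\ll\dots\ll z_m=y\}$ if $x\le y$, and $\tau(x,y)=0$ otherwise. A chain $x_0\ll\dots\ll x_m$ is a (maximising) geodesic if $m=\tau(x_0,x_m)$. For finitely supported probability measures $\mu,\nu$ on $C$, $\ell_1(\mu,\nu)=\max_\pi\sum_{a,b}\pi(a,b)\tau(a,b)$ over couplings $\pi$ of $\mu,\nu$ with $\pi(a,b)=0$ whenever $a\not\le b$ ($-\infty$ if none exist). For integers $n\ge r\ge1$, a maximising geodesic $\gamma=(x_0,\dots,x_{n+r})$, and $\alpha\in[0,1]$, put $x=x_0$, $y=x_n$, $N_x=|J(x,x_r)|$, $N_y=|J(y,x_{n+r})|$; $\mu_x$ is the uniform probability measure on $J(x,x_r)$, $\mu_y$ the uniform probability measure on $J(y,x_{n+r})$, and $$\mu_x^\alpha=\alpha\delta_x+\frac{1-\alpha}{N_x-1}\sum_{z\in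 J(x,x_r)\setminus\{x\}}\delta_z,\qquad \mu_y^\alpha=\alpha\delta_y+\frac{1-\alpha}{N_y-1}\sum_{z\in J(y,x_{n+r})\setminus\{y\}}\delta_z.$$ Then $\kappa_r(\gamma)=\frac{\ell_1(\mu_x,\mu_y)}{\tau(x,y)}-1$, $\kappa_r^\alpha(\gamma)=\frac{\ell_1(\mu_x^\alpha,\mu_y^\alpha)}{\tau(x,y)}-1$, $\kappa_r^{\mathrm{LLY}}(\gamma)=\lim_{\alpha\to1}\frac{\kappa_r^\alpha(\gamma)}{1-\alpha}$. *)

theory Defs
  imports "HOL-Probability.Probability"
begin

definition diamond :: "'a set \<Rightarrow> 'a rel \<Rightarrow> 'a \<Rightarrow> 'a \<Rightarrow> 'a set" where
  "diamond C le x z = {y \<in> C. (x, y) \<in> le \<and> (y, z) \<in> le}"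

definition causal_set :: "'a set \<Rightarrow> 'a rel \<Rightarrow> bool" where
  "causal_set C le \<longleftrightarrow>
     partial_order_on C le \<and> (\<forall>x\<in>C. \<forall>z\<in>C. finite (diamond C le x z))"

text \<open>A finite sequence \<open>(z\<^sub>0, \<dots>, z\<^sub>m)\<close> is encoded by \<open>m\<close> and a function \<open>z\<close> on \<open>nat\<close>, of which
  only the values at \<open>0, \<dots>, m\<close> matter.\<close>

definition chain_of_length :: "'a set \<Rightarrow> 'a rel \<Rightarrow> nat \<Rightarrow> (nat \<Rightarrow> 'a) \<Rightarrow> bool" where
  "chain_of_length C le m z \<longleftrightarrow>
     (\<forall>i\<le>m. z i \<in> C) \<and> (\<forall>i<m. (z i, z (Suc i)) \<in> le \<and> z i \<noteq> z (Suc i))"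

text \<open>In a causal set the set of lengths below is finite, since every chain from \<open>x\<close> to \<open>y\<close> lies in the
  finite set \<open>diamond C le x y\<close>, and it is nonempty if \<open>(x, y) \<in> le\<close>.\<close>

definition time_sep :: "'a set \<Rightarrow> 'a rel \<Rightarrow> 'a \<Rightarrow> 'a \<Rightarrow> nat" where
  "time_sep C le x y =
     (if (x, y) \<in> le
      then Max {m. \<exists>z. chain_of_length C le m z \<and> z 0 = x \<and> z m = y}
      else 0)"

definition max_geodesic :: "'a set \<Rightarrow> 'a rel \<Rightarrow> nat \<Rightarrow> (nat \<Rightarrow> 'a) \<Rightarrow> bool" where
  "max_geodesic C le m z \<longleftrightarrow> chain_of_length C le m z \<and> m = time_sep C le (z 0) (z m)"

definition causal_couplings :: "'a rel \<Rightarrow> 'a pmf \<Rightarrow> 'a pmf \<Rightarrow> ('a \<times> 'a) pmf set" where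
  "causal_couplings le \<mu> \<nu> =
     {\<pi>. map_pmf fst \<pi> = \<mu> \<and> map_pmf snd \<pi> = \<nu> \<and> (\<forall>a b. (a, b) \<notin> le \<longrightarrow> pmf \<pi> (a, b) = 0)}"

text \<open>Meant for \<open>\<mu>\<close> and \<open>\<nu>\<close> with finite support, where the maximum is attained by compactness of the
  set of couplings. A coupling vanishes outside \<open>set_pmf \<mu> \<times> set_pmf \<nu>\<close>.\<close>

definition ell1 :: "'a set \<Rightarrow> 'a rel \<Rightarrow> 'a pmf \<Rightarrow> 'a pmf \<Rightarrow> ereal" where
  "ell1 C le \<mu> \<nu> =
     (if causal_couplings le \<mu> \<nu> = {} then -\<infinity>
      else ereal (GREATEST v. \<exists>\<pi> \<in> causal_couplings le \<mu> \<nu>.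
        v = (\<Sum>(a, b) \<in> set_pmf \<mu> \<times> set_pmf \<nu>. pmf \<pi> (a, b) * real (time_sep C le a b))))"

definition unif_diamond :: "'a set \<Rightarrow> 'a rel \<Rightarrow> 'a \<Rightarrow> 'a \<Rightarrow> 'a pmf" where
  "unif_diamond C le x z = pmf_of_set (diamond C le x z)"

text \<open>The measure with idleness \<open>\<alpha>\<close> at \<open>x\<close>, given by its mass function. This is a probability mass
  function if \<open>0 \<le> \<alpha> \<le> 1\<close>, \<open>(x, z) \<in> le\<close> and \<open>x \<noteq> z\<close>; then the diamond has at least two elements.\<close>

definition lazy_diamond :: "'a set \<Rightarrow> 'a rel \<Rightarrow> real \<Rightarrow> 'a \<Rightarrow> 'a \<Rightarrow> 'a pmf" where
  "lazy_diamond C le \<alpha> x z =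
     embed_pmf (\<lambda>w. \<alpha> * indicator {x} w +
       (1 - \<alpha>) / (real (card (diamond C le x z)) - 1) * indicator (diamond C le x z - {x}) w)"

text \<open>In the curvatures the geodesic is \<open>(\<gamma> 0, \<dots>, \<gamma> (n + r))\<close>.\<close>

definition kappa :: "'a set \<Rightarrow> 'a rel \<Rightarrow> nat \<Rightarrow> nat \<Rightarrow> (nat \<Rightarrow> 'a) \<Rightarrow> ereal" where
  "kappa C le n r \<gamma> =
     ell1 C le (unif_diamond C le (\<gamma> 0) (\<gamma> r)) (unif_diamond C le (\<gamma> n) (\<gamma> (n + r)))
       / ereal (real (time_sep C le (\<gamma> 0) (\<gamma> n))) - 1"

definition kappa_idle :: "'a set \<Rightarrow> 'a rel \<Rightarrow> real \<Rightarrow> nat \<Rightarrow> nat \<Rightarrow> (nat \<Rightarrow> 'a) \<Rightarrow> ereal" where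
  "kappa_idle C le \<alpha> n r \<gamma> =
     ell1 C le (lazy_diamond C le \<alpha> (\<gamma> 0) (\<gamma> r)) (lazy_diamond C le \<alpha> (\<gamma> n) (\<gamma> (n + r)))
       / ereal (real (time_sep C le (\<gamma> 0) (\<gamma> n))) - 1"

text \<open>Since \<open>\<alpha> \<in> [0, 1]\<close>, the limit \<open>\<alpha> \<rightarrow> 1\<close> is from the left. \<open>Lim\<close> is unspecified if the limit does not
  exist, so a statement about \<open>kappa_LLY\<close> has to assert convergence separately.\<close>

definition LLY_quotient :: "'a set \<Rightarrow> 'a rel \<Rightarrow> nat \<Rightarrow> nat \<Rightarrow> (nat \<Rightarrow> 'a) \<Rightarrow> real \<Rightarrow> ereal" where
  "LLY_quotient C le n r \<gamma> \<alpha> = kappa_idle C le \<alpha> n r \<gamma> / ereal (1 - \<alpha>)"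

definition kappa_LLY :: "'a set \<Rightarrow> 'a rel \<Rightarrow> nat \<Rightarrow> nat \<Rightarrow> (nat \<Rightarrow> 'a) \<Rightarrow> ereal" where
  "kappa_LLY C le n r \<gamma> = Lim (at_left 1) (LLY_quotient C le n r \<gamma>)"

end

theory Submission
  imports Defs
begin

text \<open>Along a maximising geodesic, \<open>\<tau>(x\<^sub>i, x\<^sub>j) = j - i\<close> for \<open>i \<le> j\<close>, by superadditivity of \<open>\<tau>\<close>. On the
  points of the geodesic \<open>\<tau>\<close> is therefore the difference of a potential, so all causal couplings of two
  measures supported there have the same cost. If the second measure is the first one translated by
  \<open>n\<close> steps, this cost is \<open>n = \<tau>(x\<^sub>0, x\<^sub>n)\<close>. The measures in both parts are of this
  kind: for \<open>r = 1\<close> the diamonds consist of two consecutive points of the geodesic, and for \<open>\<alpha> = 1\<close>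
  the measures are Dirac measures.\<close>

section \<open>Order and chains in a causal set\<close>

context
  fixes C :: "'a set" and le :: "'a rel"
  assumes causal: "causal_set C le"
begin

lemma le_refl: "x \<in> C \<Longrightarrow> (x, x) \<in> le"
  using causal by (auto simp: causal_set_def partial_order_on_def preorder_on_def refl_on_def)

lemma le_trans: "(x, y) \<in> le \<Longrightarrow> (y, z) \<in> le \<Longrightarrow> (x, z) \<in> le"
  using causal by (auto simp: causal_set_def partial_order_on_def preorder_on_def dest: transD)

lemma le_antisym: "(x, y) \<in> le \<Longrightarrow> (y, x) \<in> le \<Longrightarrow> x = y"
  using causal by (auto simp: causal_set_def partial_order_on_def dest: antisymD)

lemma chain_mono:
  assumes "chain_of_length C le m z" "i \<le> j" "j \<le> m"
  shows "(z i, z j) \<in> le"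
  using assms(2,3)
proof (induction j rule: dec_induct)
  case base
  then show ?case using assms(1) le_refl by (auto simp: chain_of_length_def)
next
  case (step k)
  then have "(z k, z (Suc k)) \<in> le" using assms(1) by (auto simp: chain_of_length_def)
  with step show ?case using le_trans by simp
qed

text \<open>If \<open>z i = z j\<close> with \<open>i < j\<close>, then \<open>z (Suc i)\<close>
  lies between two equal points, so antisymmetry gives \<open>z i = z (Suc i)\<close>, which a chain
  excludes.\<close>

lemma chain_inj:
  assumes "chain_of_length C le m z"
  shows "inj_on z {..m}"
proof (rule linorder_inj_onI)
  fix i j assume *: "i < j" "i \<in> {..m}" "j \<in> {..m}"
  show "z i \<noteq> z j"
  proof
    assume "z i = z j"
    moreover have "(z (Suc i), z j) \<in> le" using chain_mono[OF assms, of "Suc i" j] * by simp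
    moreover have "(z i, z (Suc i)) \<in> le" "z i \<noteq> z (Suc i)"
      using assms * by (auto simp: chain_of_length_def)
    ultimately show False using le_antisym by simp
  qed
qed auto

text \<open>A chain of length \<open>m\<close> visits \<open>m + 1\<close> distinct points of the
  finite diamond. This makes the \<open>Max\<close> in \<open>time_sep\<close> a genuine
  maximum.\<close>

lemma finite_chain_lengths:
  assumes "x \<in> C" "y \<in> C"
  shows "finite {m. \<exists>z. chain_of_length C le m z \<and> z 0 = x \<and> z m = y}"
proof (rule finite_subset)
  have fin: "finite (diamond C le x y)"
    using causal assms by (auto simp: causal_set_def)
  show "{m. \<exists>z. chain_of_length C le m z \<and> z 0 = x \<and> z m = y} \<subseteq> {..card (diamond C le x y)}"
  proof
    fix m assume "m \<in> {m. \<exists>z. chain_of_length C le m z \<and> z 0 = x \<and> z m = y}"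
    then obtain z where z: "chain_of_length C le m z" and "z 0 = x" "z m = y"
      by blast
    then have "z ` {..m} \<subseteq> diamond C le x y"
      using chain_mono[OF z, of 0] chain_mono[OF z, of _ m]
      by (auto simp: diamond_def chain_of_length_def)
    then have "card (z ` {..m}) \<le> card (diamond C le x y)"
      using fin by (rule card_mono[rotated])
    then show "m \<in> {..card (diamond C le x y)}"
      using card_image[OF chain_inj[OF z]] by simp
  qed
qed simp

section \<open>Time separation: attainment and superadditivity\<close>

lemma time_sep_ge:
  assumes "chain_of_length C le m z"
  shows "m \<le> time_sep C le (z 0) (z m)"
proof -
  have "z 0 \<in> C" "z m \<in> C" using assms by (auto simp: chain_of_length_def)
  from Max_ge[OF finite_chain_lengths[OF this], of m] show ?thesis
    using assms chain_mono[OF assms, of 0 m] by (auto simp: time_sep_def)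
qed

lemma time_sep_attained:
  assumes "x \<in> C" "y \<in> C" "(x, y) \<in> le"
  obtains z where "chain_of_length C le (time_sep C le x y) z" "z 0 = x" "z (time_sep C le x y) = y"
proof -
  let ?S = "{m. \<exists>z. chain_of_length C le m z \<and> z 0 = x \<and> z m = y}"
  have "?S \<noteq> {}"
  proof (cases "x = y")
    case True
    then have "chain_of_length C le 0 (\<lambda>_. x)" using assms by (simp add: chain_of_length_def)
    with True show ?thesis by blast
  next
    case False
    then have "chain_of_length C le 1 (\<lambda>i. if i = 0 then x else y)"
      using assms by (simp add: chain_of_length_def)
    then have "1 \<in> ?S" by force
    then show ?thesis by blast
  qed
  from Max_in[OF finite_chain_lengths[OF assms(1,2)] this] show ?thesis
    using assms(3) that by (auto simp: time_sep_def)
qed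

lemma chain_append:
  assumes "chain_of_length C le m z" "chain_of_length C le k w" "z m = w 0"
  shows "chain_of_length C le (m + k) (\<lambda>i. if i \<le> m then z i else w (i - m))"
  unfolding chain_of_length_def
proof (intro conjI allI impI)
  fix i assume "i < m + k"
  \<comment> \<open>A step lies in \<open>z\<close>, or starts at the junction
    \<open>z m = w 0\<close>, or lies in \<open>w\<close>.\<close>
  then consider "i < m" | "i = m" "0 < k" | "m < i" "i - m < k" by linarith
  then have "(if i \<le> m then z i else w (i - m), if Suc i \<le> m then z (Suc i) else w (Suc i - m)) \<in> le \<and>
    (if i \<le> m then z i else w (i - m)) \<noteq> (if Suc i \<le> m then z (Suc i) else w (Suc i - m))"
  proof cases
    case 3
    then have "Suc i - m = Suc (i - m)" by simp
    with 3 show ?thesis using assms(2) by (simp add: chain_of_length_def)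
  qed (use assms in \<open>auto simp: chain_of_length_def\<close>)
  then show "(if i \<le> m then z i else w (i - m), if Suc i \<le> m then z (Suc i) else w (Suc i - m)) \<in> le"
    and "(if i \<le> m then z i else w (i - m)) \<noteq> (if Suc i \<le> m then z (Suc i) else w (Suc i - m))"
    by blast+
qed (use assms in \<open>auto simp: chain_of_length_def\<close>)

text \<open>Longest chains from \<open>x\<close> to \<open>y\<close> and from \<open>y\<close> to
  \<open>v\<close> concatenate to a chain from \<open>x\<close> to \<open>v\<close>.\<close>

lemma time_sep_superadditive:
  assumes "x \<in> C" "y \<in> C" "v \<in> C" "(x, y) \<in> le" "(y, v) \<in> le"
  shows "time_sep C le x y + time_sep C le y v \<le> time_sep C le x v"
proof -
  let ?m = "time_sep C le x y" and ?k = "time_sep C le y v"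
  obtain z where z: "chain_of_length C le ?m z" "z 0 = x" "z ?m = y"
    using time_sep_attained assms by blast
  obtain w where w: "chain_of_length C le ?k w" "w 0 = y" "w ?k = v"
    using time_sep_attained assms by blast
  have "chain_of_length C le (?m + ?k) (\<lambda>i. if i \<le> ?m then z i else w (i - ?m))"
    using chain_append z w by simp
  \<comment> \<open>If \<open>?k = 0\<close>, the end of the glued chain is read off from
    \<open>z\<close> rather than \<open>w\<close>; then \<open>y = v\<close>.\<close>
  from time_sep_ge[OF this] show ?thesis
    using z w by (cases "?k = 0") auto
qed

lemma time_sep_pos:
  assumes "x \<in> C" "y \<in> C" "(x, y) \<in> le" "x \<noteq> y"
  shows "0 < time_sep C le x y"
  using time_sep_attained[OF assms(1-3)] assms(4) by (metis gr0I)

section \<open>Maximising geodesics\<close>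

lemma chain_segment:
  assumes "chain_of_length C le m z" "i + k \<le> m"
  shows "chain_of_length C le k (\<lambda>l. z (i + l))"
  using assms by (auto simp: chain_of_length_def)

text \<open>The segments bound the three separations \<open>0\<close> to \<open>i\<close>,
  \<open>i\<close> to \<open>j\<close>, \<open>j\<close> to \<open>m\<close> from below by
  \<open>i\<close>, \<open>j - i\<close>, \<open>m - j\<close>. By superadditivity their sum is at
  most \<open>m\<close>, so all three bounds are equalities.\<close>

lemma time_sep_geodesic:
  assumes geo: "max_geodesic C le m z" and ij: "i \<le> j" "j \<le> m"
  shows "time_sep C le (z i) (z j) = j - i"
proof -
  have ch: "chain_of_length C le m z" and m: "time_sep C le (z 0) (z m) = m"
    using geo by (auto simp: max_geodesic_def)
  have ge: "l - k \<le> time_sep C le (z k) (z l)" if "k \<le> l" "l \<le> m" for k l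
    using time_sep_ge[OF chain_segment[OF ch, of k "l - k"]] that by simp
  have inC: "z k \<in> C" if "k \<le> m" for k
    using ch that by (simp add: chain_of_length_def)
  have "time_sep C le (z 0) (z i) + time_sep C le (z i) (z j) \<le> time_sep C le (z 0) (z j)"
    and "time_sep C le (z 0) (z j) + time_sep C le (z j) (z m) \<le> time_sep C le (z 0) (z m)"
    using ij inC chain_mono[OF ch] by (auto intro!: time_sep_superadditive)
  with ge[of 0 i] ge[of i j] ge[of j m] ij m show ?thesis by linarith
qed

text \<open>A third point of the diamond would split a time separation of 1 into two positive
  integers.\<close>

lemma diamond_geodesic_Suc:
  assumes geo: "max_geodesic C le m z" and i: "i < m"
  shows "diamond C le (z i) (z (Suc i)) = {z i, z (Suc i)}"
proof
  have ch: "chain_of_length C le m z"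
    using geo by (auto simp: max_geodesic_def)
  then have inC: "z i \<in> C" "z (Suc i) \<in> C" and le: "(z i, z (Suc i)) \<in> le"
    using i by (auto simp: chain_of_length_def)
  show "diamond C le (z i) (z (Suc i)) \<subseteq> {z i, z (Suc i)}"
  proof
    fix y assume "y \<in> diamond C le (z i) (z (Suc i))"
    then have y: "y \<in> C" "(z i, y) \<in> le" "(y, z (Suc i)) \<in> le"
      by (auto simp: diamond_def)
    have "time_sep C le (z i) y + time_sep C le y (z (Suc i)) \<le> 1"
      using time_sep_superadditive[of "z i" y "z (Suc i)"] y inC
        time_sep_geodesic[OF geo, of i "Suc i"] i by simp
    then show "y \<in> {z i, z (Suc i)}"
      using time_sep_pos[of "z i" y] time_sep_pos[of y "z (Suc i)"] y inC by fastforce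
  qed
  show "{z i, z (Suc i)} \<subseteq> diamond C le (z i) (z (Suc i))"
    using inC le le_refl by (auto simp: diamond_def)
qed

section \<open>Transport cost along a geodesic\<close>

text \<open>Both measures are images of one law \<open>p\<close> on indices, which encodes that the
  second is the first shifted by \<open>n\<close>. The cost of a causal coupling depends only on its
  marginals, so it suffices to exhibit one such coupling.\<close>

lemma ell1_translate_geodesic:
  assumes geo: "max_geodesic C le (n + r) z" and rn: "r \<le> n" and p: "set_pmf p \<subseteq> {..r}"
  shows "ell1 C le (map_pmf z p) (map_pmf (\<lambda>i. z (n + i)) p) = ereal (real n)"
proof -
  let ?\<mu> = "map_pmf z p" and ?\<nu> = "map_pmf (\<lambda>i. z (n + i)) p"
  have ch: "chain_of_length C le (n + r) z"
    using geo by (auto simp: max_geodesic_def)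
  have finp: "finite (set_pmf p)"
    using p finite_subset by blast
  \<comment> \<open>The potential: along the geodesic, \<open>f\<close> is the index.\<close>
  define f where "f = (\<lambda>w. real (time_sep C le (z 0) w))"
  have f: "f (z i) = real i" if "i \<le> n + r" for i
    using time_sep_geodesic[OF geo, of 0 i] that by (simp add: f_def)
  have pot: "real (time_sep C le a b) = f b - f a" if "a \<in> set_pmf ?\<mu>" "b \<in> set_pmf ?\<nu>" for a b
  proof -
    obtain i j where ij: "a = z i" "b = z (n + j)" "i \<le> r" "j \<le> r"
      using \<open>a \<in> set_pmf ?\<mu>\<close> \<open>b \<in> set_pmf ?\<nu>\<close> p by auto
    \<comment> \<open>Here \<open>r \<le> n\<close> enters:
      \<open>i \<le> r \<le> n \<le> n + j\<close>, so every point of the first support precedes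
      every point of the second.\<close>
    with f[of i] f[of "n + j"] time_sep_geodesic[OF geo, of i "n + j"] rn show ?thesis
      by (simp add: of_nat_diff)
  qed
  have cost: "(\<Sum>(a, b)\<in>set_pmf ?\<mu> \<times> set_pmf ?\<nu>. pmf \<pi> (a, b) * real (time_sep C le a b)) = real n"
    if "\<pi> \<in> causal_couplings le ?\<mu> ?\<nu>" for \<pi>
  proof -
    have mu: "map_pmf fst \<pi> = ?\<mu>" and nu: "map_pmf snd \<pi> = ?\<nu>"
      using that by (auto simp: causal_couplings_def)
    have "fst ` set_pmf \<pi> = set_pmf ?\<mu>" "snd ` set_pmf \<pi> = set_pmf ?\<nu>"
      using mu nu by (metis set_map_pmf)+
    then have sub: "set_pmf \<pi> \<subseteq> set_pmf ?\<mu> \<times> set_pmf ?\<nu>"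
      by (metis subset_fst_snd)
    have fin: "finite (set_pmf ?\<mu> \<times> set_pmf ?\<nu>)"
      using finp by simp
    have int: "integrable \<pi> (g :: _ \<Rightarrow> real)" for g
      using finite_subset[OF sub fin] by (rule integrable_measure_pmf_finite)
    have intp: "integrable p (g :: _ \<Rightarrow> real)" for g
      using finp by (rule integrable_measure_pmf_finite)
    \<comment> \<open>As the cost is a potential difference, its expectation under
      \<open>\<pi>\<close> splits into expectations under the two marginals, both of which pull back
      to \<open>p\<close>.\<close>
    have "(\<Sum>(a, b)\<in>set_pmf ?\<mu> \<times> set_pmf ?\<nu>. pmf \<pi> (a, b) * real (time_sep C le a b)) =
        (\<Sum>ab\<in>set_pmf ?\<mu> \<times> set_pmf ?\<nu>. pmf \<pi> ab *\<^sub>R (f (snd ab) - f (fst ab)))"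
      by (intro sum.cong) (auto simp: pot)
    also have "\<dots> = measure_pmf.expectation \<pi> (\<lambda>ab. f (snd ab) - f (fst ab))"
      using sub fin by (intro integral_measure_pmf[symmetric]) auto
    also have "\<dots> = measure_pmf.expectation (map_pmf snd \<pi>) f - measure_pmf.expectation (map_pmf fst \<pi>) f"
      using int by simp
    also have "\<dots> = measure_pmf.expectation p (\<lambda>i. f (z (n + i)) - f (z i))"
      unfolding mu nu using intp by simp
    also have "\<dots> = measure_pmf.expectation p (\<lambda>i. real n)"
      using p by (intro integral_cong_AE) (auto simp: AE_measure_pmf_iff f subset_iff)
    finally show ?thesis by simp
  qed
  \<comment> \<open>The translation coupling moves each \<open>z i\<close> to
    \<open>z (n + i)\<close>. It rules out the value \<open>-\<infinity>\<close>, and by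
    \<open>cost\<close> the set under \<open>GREATEST\<close> is the singleton of
    \<open>real n\<close>.\<close>
  let ?\<pi> = "map_pmf (\<lambda>i. (z i, z (n + i))) p"
  have "?\<pi> \<in> causal_couplings le ?\<mu> ?\<nu>"
    unfolding causal_couplings_def
    using p chain_mono[OF ch] by (auto simp: pmf.map_comp o_def pmf_eq_0_set_pmf)
  then show ?thesis
    using cost unfolding ell1_def by (auto intro!: Greatest_equality)
qed

end

section \<open>The measures as images of Bernoulli and Dirac laws\<close>

lemma embed_pmf_pmf: "embed_pmf (pmf p) = p"
  by (rule pmf_eqI) (simp add: pmf_embed_pmf nn_integral_pmf)

text \<open>The coefficient of the punctured diamond has numerator 0, so only the mass at
  \<open>x\<close> remains.\<close>

lemma lazy_diamond_1: "lazy_diamond C le 1 x z = return_pmf x"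
proof -
  have "(\<lambda>w. 1 * indicator {x} w +
       (1 - 1) / (real (card (diamond C le x z)) - 1) * indicator (diamond C le x z - {x}) w) =
     pmf (return_pmf x)"
    by (auto simp: pmf_return indicator_def fun_eq_iff)
  then show ?thesis
    by (simp only: lazy_diamond_def embed_pmf_pmf)
qed

text \<open>The normalising factor is \<open>2 - 1 = 1\<close>, so the mass left for
  \<open>z\<close> is \<open>1 - \<alpha>\<close>.\<close>

lemma lazy_diamond_two_points:
  assumes "diamond C le x z = {x, z}" "x \<noteq> z" "0 \<le> \<alpha>" "\<alpha> \<le> 1"
  shows "lazy_diamond C le \<alpha> x z = map_pmf (\<lambda>b. if b then x else z) (bernoulli_pmf \<alpha>)"
proof -
  have "(\<lambda>w. \<alpha> * indicator {x} w +
       (1 - \<alpha>) / (real (card (diamond C le x z)) - 1) * indicator (diamond C le x z - {x}) w) =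
     pmf (map_pmf (\<lambda>b. if b then x else z) (bernoulli_pmf \<alpha>))"
    using assms by (auto simp: map_pmf_def pmf_bind pmf_return indicator_def fun_eq_iff)
  then show ?thesis
    by (simp only: lazy_diamond_def embed_pmf_pmf)
qed

text \<open>The fair Bernoulli law is uniform on the booleans, and an injective map carries it to
  the uniform law on its range.\<close>

lemma unif_diamond_two_points:
  assumes "diamond C le x z = {x, z}" "x \<noteq> z"
  shows "unif_diamond C le x z = map_pmf (\<lambda>b. if b then x else z) (bernoulli_pmf (1/2))"
proof -
  have "inj (\<lambda>b. if b then x else z)" "range (\<lambda>b. if b then x else z) = {x, z}"
    using assms(2) by (auto simp: inj_def)
  then show ?thesis
    by (simp add: unif_diamond_def assms(1) bernoulli_pmf_half_conv_pmf_of_set map_pmf_of_set_inj)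
qed

text \<open>Reading \<open>True\<close> as index 0 and \<open>False\<close> as index 1 turns
  \<open>q\<close> into an index law, so this is the translation result for
  \<open>r = 1\<close>.\<close>

lemma ell1_two_points_geodesic:
  assumes C: "causal_set C le" and geo: "max_geodesic C le (n + 1) \<gamma>" and "1 \<le> n"
  shows "ell1 C le (map_pmf (\<lambda>b. if b then \<gamma> 0 else \<gamma> 1) q)
    (map_pmf (\<lambda>b. if b then \<gamma> n else \<gamma> (n + 1)) q) = ereal (real n)"
proof -
  let ?p = "map_pmf (\<lambda>b. if b then 0 else 1 :: nat) q"
  have "set_pmf ?p \<subseteq> {..1}" by auto
  note ell1_translate_geodesic[OF C geo \<open>1 \<le> n\<close> this]
  moreover have "map_pmf \<gamma> ?p = map_pmf (\<lambda>b. if b then \<gamma> 0 else \<gamma> 1) q"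
    "map_pmf (\<lambda>i. \<gamma> (n + i)) ?p = map_pmf (\<lambda>b. if b then \<gamma> n else \<gamma> (n + 1)) q"
    by (auto simp: pmf.map_comp intro!: map_pmf_cong)
  ultimately show ?thesis by simp
qed

section \<open>Vanishing of the curvatures\<close>

theorem proposition3p5:
  fixes C :: "'a set" and le :: "'a rel"
  assumes "causal_set C le"
  shows "(\<forall>n \<gamma> \<alpha>. n \<ge> 1 \<and> max_geodesic C le (n + 1) \<gamma> \<and> 0 \<le> \<alpha> \<and> \<alpha> \<le> 1 \<longrightarrow>
            kappa C le n 1 \<gamma> = 0 \<and>
            kappa_idle C le \<alpha> n 1 \<gamma> = 0 \<and>
            (LLY_quotient C le n 1 \<gamma> \<longlongrightarrow> kappa_LLY C le n 1 \<gamma>) (at_left 1) \<and>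
            kappa_LLY C le n 1 \<gamma> = 0) \<and>
         (\<forall>n r \<gamma>. n \<ge> r \<and> r \<ge> 1 \<and> max_geodesic C le (n + r) \<gamma> \<longrightarrow>
            kappa_idle C le 1 n r \<gamma> = 0)"
proof (intro conjI allI impI; elim conjE)
  fix n r \<gamma> assume rn: "r \<le> n" "1 \<le> r" and geo: "max_geodesic C le (n + r) \<gamma>"
  \<comment> \<open>The Dirac law at index 0 has the images \<open>return_pmf (\<gamma> 0)\<close>
    and \<open>return_pmf (\<gamma> n)\<close>.\<close>
  have "ell1 C le (return_pmf (\<gamma> 0)) (return_pmf (\<gamma> n)) = ereal (real n)"
    using ell1_translate_geodesic[OF assms geo rn(1), of "return_pmf 0"] by simp
  moreover have "time_sep C le (\<gamma> 0) (\<gamma> n) = n"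
    using time_sep_geodesic[OF assms geo, of 0 n] by simp
  ultimately show "kappa_idle C le 1 n r \<gamma> = 0"
    using rn by (simp add: kappa_idle_def lazy_diamond_1 one_ereal_def)
next
  fix n \<gamma> and \<alpha> :: real
  assume n: "1 \<le> n" and geo: "max_geodesic C le (n + 1) \<gamma>" and \<alpha>: "0 \<le> \<alpha>" "\<alpha> \<le> 1"
  have diam: "diamond C le (\<gamma> 0) (\<gamma> 1) = {\<gamma> 0, \<gamma> 1}"
    "diamond C le (\<gamma> n) (\<gamma> (n + 1)) = {\<gamma> n, \<gamma> (n + 1)}"
    using diamond_geodesic_Suc[OF assms geo, of 0] diamond_geodesic_Suc[OF assms geo, of n] by auto
  have ne: "\<gamma> 0 \<noteq> \<gamma> 1" "\<gamma> n \<noteq> \<gamma> (n + 1)"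
    using geo by (auto simp: max_geodesic_def chain_of_length_def)
  note ell1 = ell1_two_points_geodesic[OF assms geo n]
  have ts: "time_sep C le (\<gamma> 0) (\<gamma> n) = n"
    using time_sep_geodesic[OF assms geo, of 0 n] by simp
  show "kappa C le n 1 \<gamma> = 0"
    unfolding kappa_def unif_diamond_two_points[OF diam(1) ne(1)]
      unif_diamond_two_points[OF diam(2) ne(2)] ell1 ts
    using n by (simp add: one_ereal_def)
  \<comment> \<open>Stated for every idleness \<open>\<beta>\<close>, since the limit needs it for
    all values near 1.\<close>
  have idle: "kappa_idle C le \<beta> n 1 \<gamma> = 0" if "0 \<le> \<beta>" "\<beta> \<le> 1" for \<beta>
    unfolding kappa_idle_def lazy_diamond_two_points[OF diam(1) ne(1) that]
      lazy_diamond_two_points[OF diam(2) ne(2) that] ell1 ts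
    using n by (simp add: one_ereal_def)
  show "kappa_idle C le \<alpha> n 1 \<gamma> = 0"
    using idle \<alpha> by simp
  \<comment> \<open>On this interval the idle curvature vanishes, so the quotient is constantly 0
    near 1 and no rate of convergence has to be estimated.\<close>
  have "eventually (\<lambda>\<beta>. \<beta> \<in> {0<..<1}) (at_left (1::real))"
    by (rule eventually_at_leftI[of 0]) auto
  then have "eventually (\<lambda>\<beta>. LLY_quotient C le n 1 \<gamma> \<beta> = 0) (at_left 1)"
    by eventually_elim (use idle in \<open>simp add: LLY_quotient_def\<close>)
  then have lim: "(LLY_quotient C le n 1 \<gamma> \<longlongrightarrow> 0) (at_left 1)"
    by (rule tendsto_eventually)
  show "kappa_LLY C le n 1 \<gamma> = 0"
    \<comment> \<open>The filter \<open>at_left 1\<close> is nontrivial, so the limit is unique and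
      \<open>Lim\<close> picks the value 0.\<close>
    unfolding kappa_LLY_def using lim by (intro tendsto_Lim) auto
  with lim show "(LLY_quotient C le n 1 \<gamma> \<longlongrightarrow> kappa_LLY C le n 1 \<gamma>) (at_left 1)"
    by simp
qed

end
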